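(* Let $B=\mathbb{F}_2$, $F=\mathbb{F}_{2^\ell}$ with $\ell>1$, let $\mathcal{A}$ be a $d$-dimensional $B$-linear subspace of $F$, and let $n=2^d$. Then the I/O cost (with respect to any basis of $F$ over $B$) of any linear repair scheme over $B$ for any node of ${\rm RS}(\mathcal{A},2^d-3)$ satisfies $$\gamma_{I/O}\ \geq\ (n-1)\ell-(\ell-d+2)2^{d-1}.$$
   Context: ${\rm Tr}_{F/B}$ is the trace from $F$ to $B$. For $\mathcal{A}=\{\alpha_1,\dots,\alpha_n\}\subseteq F$ (distinct elements) and $1\le k<n$, ${\rm RS}(\mathcal{A},k)=\{(f(\alpha_1),\dots,f(\alpha_n)): f\in F[x],\ \deg f\le k-1\}$; coordinate $i$ is called node $i$. When $\mathcal{A}$ is a $B$-linear subspace of $F$, ${\rm RS}(\mathcal{A},k)^\perp={\rm RS}(\mathcal{A},n-k)$. A linear repair scheme (over $B$) for node $i^*$ of ${\rm RS}(\mathcal{A},k)$ is a list of $\ell$ polynomials $g_1,\dots,g_\ell\in F[x]$ of degree less than $n-k$ such that $g_1(\alpha_{i^*}),\dots,g_\ell(\alpha_{i^*})$ are linearly independent over $B$. Given a basis $\mathcal{B}=\{\beta^{(1)},\dots,\beta^{(\ell)}\}$ of $F$ over $B$, for $i\in\{1,\dots,n\}$ let $W_i$ be the $\ell\times\ell$ matrix over $B$ whose $(j,s)$ entry is ${\rm Tr}_{F/B}(g_j(\alpha_i)\beta^{(s)})$. The I/O cost with respect to $\mathcal{B}$ is $\gamma_{I/O}=\sum_{i=1}^n{\rm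 nz}(W_i)-\ell=\sum_{i\ne i^*}{\rm nz}(W_i)$, where ${\rm nz}(W)$ is the number of nonzero columns of $W$. *)

theory Defs
  imports
    "HOL-Computational_Algebra.Computational_Algebra"
    "HOL-Number_Theory.Residues"
    "HOL-Library.Cardinality"
    "HOL-Library.Z2"
    "Jordan_Normal_Form.Matrix"
begin

text \<open>
  The base field \<open>\<bbbF>\<^sub>2\<close> is the type \<^typ>\<open>bit\<close>; the extension field \<open>F\<close> is a type of class
  \<open>finite_field\<close> with \<open>2\<^sup>l\<close> elements. The map \<open>bit_embed\<close> is the unique field embedding
  of \<open>\<bbbF>\<^sub>2\<close> into \<open>F\<close>, and linear algebra over \<open>\<bbbF>\<^sub>2\<close> is that of the vector space given by \<open>bit_scale\<close>.
\<close>

definition bit_embed :: "bit \<Rightarrow> 'a::field" where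
  "bit_embed c = (if c = 0 then 0 else 1)"

definition bit_scale :: "bit \<Rightarrow> 'a::field \<Rightarrow> 'a" where
  "bit_scale c x = bit_embed c * x"

lemma CHAR_eq_2:
  assumes "card (UNIV :: 'a::finite_field set) = 2 ^ l"
  shows "CHAR('a) = 2"
proof -
  have "prime CHAR('a)"
    by (simp add: prime_CHAR_semidom)
  moreover have "CHAR('a) dvd 2 ^ l"
    using CHAR_dvd_CARD[where 'a = 'a] assms by simp
  ultimately show ?thesis
    by (metis prime_dvd_power primes_dvd_imp_eq two_is_prime_nat)
qed

lemma vector_space_bit_scale:
  assumes "card (UNIV :: 'a::finite_field set) = 2 ^ l"
  shows "vector_space (bit_scale :: bit \<Rightarrow> 'a \<Rightarrow> 'a)"
proof -
  have "of_nat CHAR('a) = (0 :: 'a)"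
    by (rule of_nat_CHAR)
  hence two: "(2 :: 'a) = 0"
    by (simp add: CHAR_eq_2[OF assms])
  have add: "bit_embed (a + b) = (bit_embed a + bit_embed b :: 'a)" for a b
    by (cases a; cases b) (simp_all add: bit_embed_def two)
  have mult: "bit_embed (a * b) = (bit_embed a * bit_embed b :: 'a)" for a b
    by (cases a; cases b) (simp_all add: bit_embed_def)
  have one: "bit_embed 1 = (1 :: 'a)"
    by (simp add: bit_embed_def)
  show ?thesis
    by unfold_locales (simp_all only: bit_scale_def add mult one distrib_left distrib_right mult.assoc mult_1_left)
qed

text \<open>
  Since \<open>F\<close> has degree \<open>l\<close> over \<open>\<bbbF>\<^sub>2\<close>, the trace of \<open>x\<close> is the sum of its conjugates
  \<open>x, x\<^sup>2, x\<^sup>4, \<dots>\<close>, regarded as an element of \<open>\<bbbF>\<^sub>2\<close>. Existence of that element is shown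
  in \<open>bit_embed_field_trace\<close>.
\<close>

definition field_trace :: "nat \<Rightarrow> 'a::field \<Rightarrow> bit" where
  "field_trace l x = (THE c. bit_embed c = (\<Sum>i<l. x ^ (2 ^ i)))"

lemma bit_embed_field_trace:
  fixes x :: "'a::finite_field"
  assumes "CARD('a) = 2 ^ l"
  shows "bit_embed (field_trace l x) = (\<Sum>i<l. x ^ (2 ^ i))"
proof -
  let ?T = "\<Sum>i<l. x ^ (2 ^ i)"
  have char: "CHAR('a) = 2"
    by (rule CHAR_eq_2[OF assms])
  have fix_x: "x ^ (2 ^ l) = x"
    using finite_field_power_card_eq_same[of x] assms by simp
  have "?T ^ 2 = (\<Sum>i<l. (x ^ (2 ^ i)) ^ 2)"
    by (rule freshmans_dream_sum) (simp_all add: char)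
  also have "\<dots> = (\<Sum>i<l. x ^ (2 ^ Suc i))"
    by (simp add: power_mult [symmetric] mult.commute)
  also have "\<dots> = ?T"
    using sum.lessThan_Suc_shift[of "\<lambda>i. x ^ (2 ^ i)" l] fix_x by simp
  finally have "?T * (?T - 1) = 0"
    by (simp add: power2_eq_square algebra_simps)
  hence "?T = 0 \<or> ?T = 1"
    by simp
  hence "\<exists>c. bit_embed c = ?T"
  proof
    assume "?T = 0"
    hence "bit_embed 0 = ?T" by (simp add: bit_embed_def)
    thus ?thesis ..
  next
    assume "?T = 1"
    hence "bit_embed 1 = ?T" by (simp add: bit_embed_def)
    thus ?thesis ..
  qed
  moreover have "c = c'" if "bit_embed c = ?T" "bit_embed c' = ?T" for c c'
    using that by (cases c; cases c') (auto simp: bit_embed_def)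
  ultimately have "\<exists>!c. bit_embed c = ?T"
    by blast
  thus ?thesis
    unfolding field_trace_def by (rule theI')
qed

definition lin_indep_list :: "'a::field list \<Rightarrow> bool" where
  "lin_indep_list vs \<longleftrightarrow> distinct vs \<and> \<not> Modules.module.dependent bit_scale (set vs)"

definition basis_list :: "'a::field list \<Rightarrow> bool" where
  "basis_list bs \<longleftrightarrow> lin_indep_list bs \<and> Modules.module.span bit_scale (set bs) = UNIV"

text \<open>
  A linear repair scheme for the node with index \<open>i\<close> of the Reed-Solomon code with list of
  evaluation points \<open>pts\<close> and dimension \<open>k\<close>, over a field of degree \<open>l\<close> over \<open>\<bbbF>\<^sub>2\<close>. Here
  \<open>k < length pts\<close>, so that \<open>degree 0 = 0\<close> lets the zero polynomial count
  as one of degree less than \<open>length pts - k\<close>.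
\<close>

definition linear_repair_scheme ::
  "'a::field list \<Rightarrow> nat \<Rightarrow> nat \<Rightarrow> nat \<Rightarrow> 'a poly list \<Rightarrow> bool" where
  "linear_repair_scheme pts k l i gs \<longleftrightarrow>
     length gs = l \<and>
     (\<forall>g\<in>set gs. degree g < length pts - k) \<and>
     lin_indep_list (map (\<lambda>g. poly g (pts ! i)) gs)"

definition repair_matrix :: "nat \<Rightarrow> 'a::field list \<Rightarrow> 'a poly list \<Rightarrow> 'a \<Rightarrow> bit mat" where
  "repair_matrix l bs gs a = mat l l (\<lambda>(j, s). field_trace l (poly (gs ! j) a * bs ! s))"

definition nz :: "'b::zero mat \<Rightarrow> nat" where
  "nz W = card {s. s < dim_col W \<and> col W s \<noteq> 0\<^sub>v (dim_row W)}"

definition io_cost :: "nat \<Rightarrow> 'a::field list \<Rightarrow> 'a list \<Rightarrow> 'a poly list \<Rightarrow> int" where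
  "io_cost l pts bs gs = (\<Sum>i<length pts. int (nz (repair_matrix l bs gs (pts ! i)))) - int l"

end

theory Submission
  imports Defs
begin

text \<open>
  For fixed \<open>t\<close> the nodes whose matrix has zero \<open>t\<close>-th column form an affine subspace \<open>S\<^sub>t\<close>
  of \<open>A\<close>, because a polynomial of degree at most 2 followed by the trace is an affine map in
  characteristic 2. The failed node is not in \<open>S\<^sub>t\<close>, so \<open>S\<^sub>t\<close> is empty or of codimension
  \<open>c\<^sub>t \<ge> 1\<close>, and the claim is that \<open>l - d + 2\<close> bounds the sum of \<open>2\<close> to the power \<open>1 - c\<^sub>t\<close>
  over the nonempty \<open>S\<^sub>t\<close>. This is a Singleton-type argument: choose \<open>d - 2\<close> coordinates
  \<open>t\<close>, including those with \<open>S\<^sub>t\<close> empty and then those with \<open>c\<^sub>t\<close> largest. If the sum were too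
  large, a dimension count would give a nonzero combination of the \<open>g\<^sub>j\<close> all of whose values on \<open>A\<close>
  have vanishing coordinates outside the chosen ones, and vanishing coordinates at the failed node for
  empty \<open>S\<^sub>t\<close>. On \<open>A\<close> it takes at most \<open>2\<close> to the power \<open>d - 2\<close> values, hence some value
  more than twice, so it is constant; but then the coordinates with \<open>S\<^sub>t\<close> nonempty vanish as well.
\<close>

section \<open>A weighted choice of coordinates\<close>

lemma exists_top_subset:
  fixes q :: "'b \<Rightarrow> nat"
  assumes "finite T" and "m \<le> card T"
  shows "\<exists>M\<subseteq>T. card M = m \<and> (\<forall>x\<in>M. \<forall>y\<in>T - M. q y \<le> q x)"
  using assms(2)
proof (induction m)
  case 0
  show ?case by (rule exI[of _ "{}"]) simp
next
  case (Suc m)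
  then obtain M where M: "M \<subseteq> T" "card M = m" "\<forall>x\<in>M. \<forall>y\<in>T - M. q y \<le> q x"
    by auto
  have fin: "finite (T - M)" "finite M"
    using assms(1) M(1) finite_subset by auto
  have "T - M \<noteq> {}"
    using Suc.prems M by auto
  then have "Max (q ` (T - M)) \<in> q ` (T - M)"
    using fin by (intro Max_in) auto
  then obtain z where z: "z \<in> T - M" "q z = Max (q ` (T - M))"
    by auto
  have "q y \<le> q z" if "y \<in> T - M" for y
    using that z(2) fin by simp
  then show ?case
    using M z fin by (intro exI[of _ "insert z M"]) auto
qed

text \<open>Take for \<open>M\<close> the elements with the largest \<open>q\<close>, and let
  \<open>Q\<close> be the least value of \<open>q\<close> on it. Outside \<open>M\<close>, each
  \<open>q y * (1/2) ^ Q\<close> is at most \<open>1 - (1/2) ^ q y\<close>. By \<open>big\<close>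
  these bounds add up to less than the weight of \<open>M\<close>, which is at most
  \<open>m * (1/2) ^ Q\<close>.\<close>

lemma exists_small_complement_sum:
  fixes q :: "'b \<Rightarrow> nat"
  assumes fin: "finite T" and m: "m \<le> card T" "m > 0"
    and big: "(\<Sum>t\<in>T. (1/2::real) ^ q t) > real (card T) - real m"
  shows "\<exists>M\<subseteq>T. card M = m \<and> (\<Sum>t\<in>T - M. q t) < m"
proof -
  obtain M where M: "M \<subseteq> T" "card M = m" "\<forall>x\<in>M. \<forall>y\<in>T - M. q y \<le> q x"
    using exists_top_subset[OF fin m(1)] by blast
  have finM: "finite M" and "M \<noteq> {}"
    using M m fin finite_subset by auto
  define Q where "Q = Min (q ` M)"
  have QM: "Q \<le> q x" if "x \<in> M" for x
    using that finM by (simp add: Q_def)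
  have "Q \<in> q ` M"
    unfolding Q_def using finM \<open>M \<noteq> {}\<close> by (intro Min_in) auto
  then have QK: "q y \<le> Q" if "y \<in> T - M" for y
    using M(3) that by auto
  have step: "real (q y) * (1/2) ^ Q \<le> 1 - (1/2) ^ q y" if "y \<in> T - M" for y
  proof -
    have "real (q y) * (1/2) ^ Q \<le> real (q y) * (1/2) ^ q y"
      by (intro mult_left_mono power_decreasing QK that) auto
    also have "\<dots> \<le> (2 ^ q y - 1) * (1/2) ^ q y"
    proof (intro mult_right_mono)
      have "q y + 1 \<le> 2 ^ q y"
        using less_exp[of "q y"] by linarith
      then have "real (q y + 1) \<le> real (2 ^ q y)"
        by (rule of_nat_mono)
      then show "real (q y) \<le> 2 ^ q y - 1"
        by simp
    qed simp
    also have "\<dots> = 1 - (1/2) ^ q y"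
      by (simp add: power_divide diff_divide_distrib)
    finally show ?thesis .
  qed
  have "real (\<Sum>t\<in>T - M. q t) * (1/2) ^ Q \<le> (\<Sum>t\<in>T - M. 1 - (1/2) ^ q t)"
    unfolding of_nat_sum sum_distrib_right by (intro sum_mono step)
  also have "\<dots> = real (card T) - real m - (\<Sum>t\<in>T - M. (1/2) ^ q t)"
    using M fin m finM by (simp add: sum_subtractf card_Diff_subset of_nat_diff)
  also have "\<dots> < (\<Sum>t\<in>M. (1/2) ^ q t)"
    using big sum.subset_diff[OF M(1) fin, of "\<lambda>t. (1/2::real) ^ q t"] by simp
  also have "\<dots> \<le> (\<Sum>t\<in>M. (1/2) ^ Q)"
    by (intro sum_mono power_decreasing QM) auto
  also have "\<dots> = real m * (1/2) ^ Q"
    using M by simp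
  finally have "(\<Sum>t\<in>T - M. q t) < m"
    by (simp del: of_nat_sum)
  then show ?thesis
    using M by blast
qed

section \<open>Affine subspaces and affine maps over F_2\<close>

text \<open>In characteristic 2 the affine subspaces are the sets closed under \<open>x + y + z\<close>.\<close>

definition affine2 :: "'a::ab_group_add set \<Rightarrow> bool" where
  "affine2 S \<longleftrightarrow> (\<forall>x\<in>S. \<forall>y\<in>S. \<forall>z\<in>S. x + y + z \<in> S)"

text \<open>Affine rather than linear maps: constants qualify because
  \<open>c + c + c = c\<close>.\<close>

definition affine2_map :: "'a::ab_group_add set \<Rightarrow> ('a \<Rightarrow> bit) \<Rightarrow> bool" where
  "affine2_map A f \<longleftrightarrow> (\<forall>x\<in>A. \<forall>y\<in>A. \<forall>z\<in>A. f (x + y + z) = f x + f y + f z)"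

text \<open>Adjoining a point outside \<open>S\<close> doubles an affine set, so
  \<open>card X\<close> is the codimension of \<open>S\<close> in \<open>A\<close>. An affine map
  that vanishes on \<open>S\<close> thus needs only that many further equations to vanish on
  \<open>A\<close>.\<close>

lemma affine2_spanning_set:
  fixes S A :: "'a::ab_group_add set"
  assumes char2: "\<And>x::'a. x + x = 0" and "finite A" and "affine2 A"
    and "S \<subseteq> A" and "S \<noteq> {}" and "affine2 S"
  shows "\<exists>X. finite X \<and> X \<inter> S = {} \<and> 2 ^ card X * card S = card A \<and>
    (\<forall>f. affine2_map A f \<longrightarrow> (\<forall>x\<in>S \<union> X. f x = 0) \<longrightarrow> (\<forall>x\<in>A. f x = 0))"
  using assms(4-6)
proof (induction "card A - card S" arbitrary: S rule: less_induct)
  case less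
  have finS: "finite S"
    using less.prems assms(2) finite_subset by blast
  show ?case
  proof (cases "S = A")
    case True
    then show ?thesis by (intro exI[of _ "{}"]) auto
  next
    case False
    then obtain x x0 where x: "x \<in> A" "x \<notin> S" "x0 \<in> S"
      using less.prems by blast
    \<comment> \<open>\<open>S'\<close> will be the affine hull of \<open>S\<close> and
      \<open>x\<close>; \<open>e\<close> is the direction from \<open>x0\<close> to
      \<open>x\<close>.\<close>
    define e where "e = x + x0"
    define S' where "S' = S \<union> (\<lambda>y. y + e) ` S"
    have ee: "e + e = 0" by (rule char2)
    have mem: "s + c \<in> S'" if "s \<in> S" "c \<in> {0, e}" for s c
      using that by (auto simp: S'_def)
    have memE: "\<exists>s\<in>S. \<exists>c\<in>{0, e}. v = s + c" if "v \<in> S'" for v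
      using that unfolding S'_def by force
    have "affine2 S'"
      unfolding affine2_def
    proof (intro ballI)
      fix u v w assume "u \<in> S'" "v \<in> S'" "w \<in> S'"
      then obtain s1 c1 s2 c2 s3 c3 where
        s: "s1 \<in> S" "s2 \<in> S" "s3 \<in> S" and c: "c1 \<in> {0, e}" "c2 \<in> {0, e}" "c3 \<in> {0, e}"
        and eq: "u = s1 + c1" "v = s2 + c2" "w = s3 + c3"
        using memE by meson
      have "c1 + c2 + c3 \<in> {0, e}"
        using c ee by (auto simp: add.assoc)
      moreover have "s1 + s2 + s3 \<in> S"
        using s less.prems(3) by (auto simp: affine2_def)
      ultimately have "(s1 + s2 + s3) + (c1 + c2 + c3) \<in> S'"
        by (rule mem[rotated])
      moreover have "u + v + w = (s1 + s2 + s3) + (c1 + c2 + c3)"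
        by (simp only: eq ac_simps)
      ultimately show "u + v + w \<in> S'"
        by simp
    qed
    moreover have "S' \<subseteq> A"
    proof -
      have "y + x + x0 \<in> A" if "y \<in> S" for y
        using that x less.prems(1) assms(3) unfolding affine2_def by blast
      then show ?thesis
        using less.prems(1) by (auto simp: S'_def e_def add.assoc)
    qed
    moreover have "S' \<noteq> {}"
      using less.prems by (simp add: S'_def)
    moreover have disj: "S \<inter> (\<lambda>y. y + e) ` S = {}"
    proof (rule ccontr)
      assume "S \<inter> (\<lambda>y. y + e) ` S \<noteq> {}"
      then obtain y where "y \<in> S" "y + e \<in> S" by auto
      then have "(y + e) + y + x0 \<in> S"
        using x less.prems(3) unfolding affine2_def by blast
      moreover have "(y + e) + y + x0 = (y + y) + (x0 + x0) + x"
        by (simp add: e_def algebra_simps)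
      ultimately show False
        using x by (simp add: char2)
    qed
    moreover have cardS': "card S' = 2 * card S"
    proof -
      have "card ((\<lambda>y. y + e) ` S) = card S"
        by (rule card_image) (simp add: inj_on_def)
      then show ?thesis
        unfolding S'_def using finS disj by (simp add: card_Un_disjoint)
    qed
    moreover have "card S' \<le> card A"
      using \<open>S' \<subseteq> A\<close> assms(2) by (rule card_mono[rotated])
    moreover have "card S > 0"
      using finS less.prems by auto
    ultimately have "card A - card S' < card A - card S"
      by linarith
    from less.hyps[OF this \<open>S' \<subseteq> A\<close> \<open>S' \<noteq> {}\<close> \<open>affine2 S'\<close>]
    obtain X where X: "finite X" "X \<inter> S' = {}" "2 ^ card X * card S' = card A"
      "\<And>f. affine2_map A f \<Longrightarrow> (\<forall>x\<in>S' \<union> X. f x = 0) \<Longrightarrow> (\<forall>x\<in>A. f x = 0)"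
      by blast
    \<comment> \<open>Since \<open>x\<close> lies in \<open>S'\<close>, it is new to
      \<open>X\<close>, and inserting it matches the doubling from \<open>S\<close> to
      \<open>S'\<close>.\<close>
    have "x = x0 + e"
      by (simp add: e_def algebra_simps char2)
    then have "x \<in> S'"
      using x mem[of x0 e] by simp
    then have "x \<notin> X"
      using X(2) by blast
    have "f y = 0" if f: "affine2_map A f" "\<forall>v\<in>S \<union> insert x X. f v = 0" and "y \<in> A" for f y
    proof -
      have "f (y + x + x0) = 0" if "y \<in> S" for y
      proof -
        have "f (y + x + x0) = f y + f x + f x0"
          using f(1) that x less.prems(1) unfolding affine2_map_def by blast
        then show ?thesis
          using f(2) that x by simp
      qed
      then have "\<forall>v\<in>S' \<union> X. f v = 0"
        using f(2) by (auto simp: S'_def e_def add.assoc)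
      then show ?thesis
        using X(4)[OF f(1)] that by blast
    qed
    moreover have "insert x X \<inter> S = {}"
      using X(2) x by (auto simp: S'_def)
    moreover have "2 ^ card (insert x X) * card S = card A"
      using X(1,3) \<open>x \<notin> X\<close> cardS' by simp
    ultimately show ?thesis
      using X(1) by (intro exI[of _ "insert x X"] conjI allI impI ballI) (simp_all only: finite_insert)
  qed
qed

text \<open>Pigeonhole over the at most \<open>2 ^ card I\<close> bit patterns, recorded by their
  zero sets. It replaces rank arguments: \<open>c = 1\<close> yields two combinations meeting the
  same conditions, \<open>c = 2\<close> three nodes with the same coordinates.\<close>

lemma exists_large_fibre_bits:
  fixes h :: "'b \<Rightarrow> 'c \<Rightarrow> bit"
  assumes "finite A" and "finite I" and "card A > c * 2 ^ card I"
  shows "\<exists>Y\<subseteq>A. card Y > c \<and> (\<forall>x\<in>Y. \<forall>y\<in>Y. \<forall>i\<in>I. h x i = h y i)"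
proof -
  define F where "F x = {i\<in>I. h x i = 0}" for x
  have "\<exists>T\<in>Pow I. card A \<le> card (F -` {T} \<inter> A) * card (Pow I)"
    using assms(1,2) by (intro pigeonhole_card) (auto simp: F_def)
  then obtain T where "card A \<le> card (F -` {T} \<inter> A) * 2 ^ card I"
    using assms(2) by (auto simp: card_Pow)
  with assms(3) have "c * 2 ^ card I < card (F -` {T} \<inter> A) * 2 ^ card I"
    by linarith
  then have T: "card (F -` {T} \<inter> A) > c"
    by simp
  have "h x i = h y i" if "x \<in> F -` {T}" "y \<in> F -` {T}" "i \<in> I" for x y i
  proof -
    have "i \<in> F x \<longleftrightarrow> i \<in> F y"
      using that by simp
    then show ?thesis
      using that(3) unfolding F_def by (cases "h x i"; cases "h y i") auto
  qed
  then show ?thesis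
    using T by (intro exI[of _ "F -` {T} \<inter> A"]) auto
qed

section \<open>The trace form and linear independence over F_2\<close>

lemma add_self_eq_0:
  fixes x :: "'a::finite_field"
  assumes "CARD('a) = 2 ^ l"
  shows "x + x = 0"
proof -
  have "of_nat CHAR('a) = (0 :: 'a)"
    by (rule of_nat_CHAR)
  then have "(2 :: 'a) = 0"
    by (simp add: CHAR_eq_2[OF assms])
  then show ?thesis
    by (metis mult_2 mult_zero_left)
qed

lemma add_eq_0_imp_eq:
  fixes x y :: "'a::finite_field"
  assumes "CARD('a) = 2 ^ l" and "x + y = 0"
  shows "x = y"
proof -
  have "x + y = y + y"
    using assms(2) add_self_eq_0[OF assms(1), of y] by simp
  then show ?thesis
    by (rule add_right_imp_eq)
qed

lemma bit_embed_0_iff [simp]: "bit_embed c = (0 :: 'a::field) \<longleftrightarrow> c = 0"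
  by (simp add: bit_embed_def)

lemma field_trace_add:
  fixes x y :: "'a::finite_field"
  assumes "CARD('a) = 2 ^ l"
  shows "field_trace l (x + y) = field_trace l x + field_trace l y"
proof -
  have "(x + y) ^ (2 ^ i) = x ^ (2 ^ i) + y ^ (2 ^ i)" for i
    by (rule freshmans_dream') (auto simp: CHAR_eq_2[OF assms])
  then have eq: "(bit_embed (field_trace l (x + y)) :: 'a)
      = bit_embed (field_trace l x) + bit_embed (field_trace l y)"
    by (simp add: bit_embed_field_trace[OF assms] sum.distrib)
  have "(1::'a) + 1 = 0"
    by (rule add_self_eq_0[OF assms])
  then show ?thesis
    using eq by (cases "field_trace l x"; cases "field_trace l y"; cases "field_trace l (x + y)")
      (simp_all add: bit_embed_def)
qed

lemma field_trace_0:
  assumes "CARD('a::finite_field) = 2 ^ l"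
  shows "field_trace l (0 :: 'a) = 0"
  using field_trace_add[OF assms, of 0 0] by simp

lemma field_trace_sum:
  fixes f :: "'b \<Rightarrow> 'a::finite_field"
  assumes "CARD('a) = 2 ^ l"
  shows "field_trace l (sum f J) = (\<Sum>j\<in>J. field_trace l (f j))"
  by (induction J rule: infinite_finite_induct)
    (simp_all add: field_trace_add[OF assms] field_trace_0[OF assms])

text \<open>The trace is a polynomial of degree at most \<open>2 ^ (l - 1)\<close> with linear
  coefficient 1, so it has too few roots to vanish on all \<open>2 ^ l\<close> elements.\<close>

lemma exists_field_trace_nonzero:
  assumes card: "CARD('a::finite_field) = 2 ^ l"
  shows "\<exists>x::'a. field_trace l x \<noteq> 0"
proof (rule ccontr)
  assume "\<not> ?thesis"
  then have zero: "(\<Sum>i<l. x ^ (2 ^ i)) = 0" for x :: 'a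
    using bit_embed_field_trace[OF card, of x] by (metis bit_embed_0_iff)
  define p :: "'a poly" where "p = (\<Sum>i<l. Polynomial.monom 1 (2 ^ i))"
  have "l > 0"
  proof (rule ccontr)
    assume "\<not> l > 0"
    then have "CARD('a) = 1"
      using card by simp
    then show False
      using card_mono[of UNIV "{0, 1 :: 'a}"] by simp
  qed
  have "poly.coeff p 1 = (\<Sum>i<l. if i = 0 then 1 else 0)"
    unfolding p_def coeff_sum by (intro sum.cong) (auto simp: coeff_monom)
  then have "p \<noteq> 0"
    using \<open>l > 0\<close> by auto
  have "degree p \<le> 2 ^ (l - 1)"
    unfolding p_def
    by (rule degree_sum_le) (auto intro!: order.trans[OF degree_monom_le] power_increasing)
  also have "\<dots> < 2 ^ l"
    using \<open>l > 0\<close> by (intro power_strict_increasing) auto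
  also have "2 ^ l = card {x. poly p x = 0}"
    using zero by (simp add: card p_def poly_sum poly_monom)
  also have "\<dots> \<le> degree p"
    by (rule card_poly_roots_bound) fact
  finally show False
    by simp
qed

text \<open>Nondegeneracy of the trace form. The annihilator of \<open>v\<close> is a subspace
  containing a basis, hence everything; for \<open>v \<noteq> 0\<close> the multiples of
  \<open>v\<close> fill the field, and the trace would vanish identically.\<close>

lemma eq_0_if_traces_eq_0:
  fixes v :: "'a::finite_field"
  assumes card: "CARD('a) = 2 ^ l" and bs: "basis_list bs"
    and "\<forall>b\<in>set bs. field_trace l (v * b) = 0"
  shows "v = 0"
proof (rule ccontr)
  assume "v \<noteq> 0"
  interpret vector_space "bit_scale :: bit \<Rightarrow> 'a \<Rightarrow> 'a"
    by (rule vector_space_bit_scale[OF card])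
  have "subspace {y. field_trace l (v * y) = 0}"
    unfolding subspace_def
    by (auto simp: distrib_left field_trace_add[OF card] field_trace_0[OF card] bit_scale_def
        bit_embed_def)
  then have "span (set bs) \<subseteq> {y. field_trace l (v * y) = 0}"
    using assms(3) by (intro span_minimal) auto
  then have "field_trace l (v * y) = 0" for y
    using bs unfolding basis_list_def by auto
  from this[of "x / v" for x] show False
    using exists_field_trace_nonzero[OF card] \<open>v \<noteq> 0\<close> by simp
qed

text \<open>Over F_2 linear combinations are subset sums, so independence becomes injectivity, and
  dimensions can be compared by counting subsets.\<close>

lemma inj_on_subset_sums:
  fixes vs :: "'a::finite_field list"
  assumes card: "CARD('a) = 2 ^ l" and "lin_indep_list vs"
  shows "inj_on (\<lambda>J. \<Sum>j\<in>J. vs ! j) (Pow {..<length vs})"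
proof (rule inj_onI)
  interpret vector_space "bit_scale :: bit \<Rightarrow> 'a \<Rightarrow> 'a"
    by (rule vector_space_bit_scale[OF card])
  fix J J' assume J: "J \<in> Pow {..<length vs}" "J' \<in> Pow {..<length vs}"
    and eq: "(\<Sum>j\<in>J. vs ! j) = (\<Sum>j\<in>J'. vs ! j)"
  \<comment> \<open>Adding two equal sums gives 0 and cancels the common terms, which leaves a
    relation over the symmetric difference.\<close>
  define D where "D = (J - J') \<union> (J' - J)"
  have fin: "finite J" "finite J'"
    using J finite_subset by auto
  have D: "D \<subseteq> {..<length vs}"
    using J by (auto simp: D_def)
  have vs: "distinct vs" "independent (set vs)"
    using assms(2) by (auto simp: lin_indep_list_def)
  have inj: "inj_on ((!) vs) D"
    using D vs(1) by (intro inj_on_nth) auto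
  have "(\<Sum>v\<in>(!) vs ` D. bit_scale 1 v) = (\<Sum>j\<in>D. vs ! j)"
    using inj by (simp add: sum.reindex bit_scale_def bit_embed_def)
  also have "\<dots> = (\<Sum>j\<in>J - J'. vs ! j) + (\<Sum>j\<in>J' - J. vs ! j)"
    unfolding D_def using fin by (intro sum.union_disjoint) auto
  also have "(\<Sum>j\<in>J - J'. vs ! j) = (\<Sum>j\<in>J' - J. vs ! j)"
    using eq sum.Int_Diff[OF fin(1), of "(!) vs" J'] sum.Int_Diff[OF fin(2), of "(!) vs" J]
    by (simp add: Int_commute)
  finally have "(\<Sum>v\<in>(!) vs ` D. bit_scale 1 v) = 0"
    by (simp only: add_self_eq_0[OF card])
  moreover have "(!) vs ` D \<subseteq> set vs" "finite ((!) vs ` D)"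
    using D finite_subset by auto
  ultimately have "(!) vs ` D = {}"
    using independentD[OF vs(2), of "(!) vs ` D" "\<lambda>_. 1"] by auto
  then show "J = J'"
    by (auto simp: D_def)
qed

section \<open>Quadratic polynomials under the trace\<close>

lemma poly_degree_le_2:
  fixes p :: "'a::comm_semiring_1 poly"
  assumes "degree p \<le> 2"
  shows "poly p x = poly.coeff p 0 + poly.coeff p 1 * x + poly.coeff p 2 * x\<^sup>2"
proof -
  have "poly p x = (\<Sum>i\<le>2. poly.coeff p i * x ^ i)"
    unfolding poly_altdef using assms
    by (intro sum.mono_neutral_left) (auto simp: coeff_eq_0)
  also have "{..2::nat} = {0, 1, 2}"
    by (simp add: set_eq_iff) arith
  finally show ?thesis
    by (simp add: add.assoc)
qed

text \<open>Squaring is additive in characteristic 2, so the terms of degree 1 and 2 are additive;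
  the constant term survives because \<open>c + c + c = c\<close>.\<close>

lemma affine2_map_trace_poly:
  fixes p :: "'a::finite_field poly"
  assumes card: "CARD('a) = 2 ^ l" and "degree p \<le> 2"
  shows "affine2_map A (\<lambda>x. field_trace l (poly p x * b))"
proof -
  have "poly p (x + y + z) = poly p x + poly p y + poly p z" for x y z
  proof -
    have sq: "(u + v)\<^sup>2 = u\<^sup>2 + v\<^sup>2" for u v :: 'a
      by (rule freshmans_dream) (simp_all add: CHAR_eq_2[OF card])
    have c0: "poly.coeff p 0 = poly.coeff p 0 + poly.coeff p 0 + poly.coeff p 0"
      by (simp only: add_self_eq_0[OF card] add_0)
    have "poly p (x + y + z) = (poly.coeff p 0 + poly.coeff p 0 + poly.coeff p 0)
        + poly.coeff p 1 * (x + y + z) + poly.coeff p 2 * (x\<^sup>2 + y\<^sup>2 + z\<^sup>2)"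
      unfolding poly_degree_le_2[OF assms(2), of "x + y + z"] sq by (simp only: c0[symmetric])
    also have "\<dots> = poly p x + poly p y + poly p z"
      by (simp only: poly_degree_le_2[OF assms(2)] distrib_left distrib_right ac_simps)
    finally show ?thesis .
  qed
  then show ?thesis
    unfolding affine2_map_def by (simp add: field_trace_add[OF card] distrib_right)
qed

section \<open>Zero columns of the repair matrices\<close>

text \<open>The nodes in \<open>A\<close> whose repair matrix has zero column \<open>t\<close>, the
  set S_t of the opening explanation. Grouping by column instead of by node exposes the affine
  structure.\<close>

definition zero_nodes :: "nat \<Rightarrow> 'a::field set \<Rightarrow> 'a list \<Rightarrow> 'a poly list \<Rightarrow> nat \<Rightarrow> 'a set" where
  "zero_nodes l A bs gs t = {x\<in>A. \<forall>j<l. field_trace l (poly (gs ! j) x * bs ! t) = 0}"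

text \<open>The core dimension count. With fewer than \<open>l\<close> conditions, some nonzero
  F_2-combination \<open>p\<close> of the \<open>gs\<close> meets all of them. Its coordinates in
  \<open>K\<close> vanish on \<open>A\<close>; the others are so few that \<open>p\<close> must be
  constant, with a nonzero value at \<open>a\<close> whose coordinates nevertheless all
  vanish.\<close>

lemma quadratic_scheme_system_overdetermined:
  fixes A :: "'a::finite_field set" and gs :: "'a poly list"
  assumes card: "CARD('a) = 2 ^ l" and bs: "basis_list bs" "length bs = l"
    and gs: "length gs = l" "\<forall>g\<in>set gs. degree g \<le> 2" "lin_indep_list (map (\<lambda>g. poly g a) gs)"
    and E: "\<And>t. t < l \<Longrightarrow> t \<notin> E \<Longrightarrow> zero_nodes l A bs gs t \<noteq> {}"
    and K: "K \<subseteq> {..<l}" "E \<subseteq> {..<l}"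
    and X: "\<And>t. t \<in> K \<Longrightarrow> finite (X t)"
      "\<And>t f. t \<in> K \<Longrightarrow> affine2_map A f \<Longrightarrow> (\<forall>x\<in>zero_nodes l A bs gs t \<union> X t. f x = 0) \<Longrightarrow>
        (\<forall>x\<in>A. f x = 0)"
    and A: "card A > 2 * 2 ^ (l - card K)"
  shows "l \<le> card E + (\<Sum>t\<in>K. card (X t))"
proof (rule ccontr)
  assume less: "\<not> ?thesis"
  note tr_add = field_trace_add[OF card] and tr_sum = field_trace_sum[OF card]
  have fin: "finite E" "finite K"
    using K by (auto intro: finite_subset)
  \<comment> \<open>One condition at the failed node \<open>a\<close> for each \<open>t\<close> in
    \<open>E\<close>, and one at each point of \<open>X t\<close> for each \<open>t\<close> in
    \<open>K\<close>.\<close>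
  define I where "I = (\<lambda>t. (t, a)) ` E \<union> Sigma K X"
  define P where "P J = (\<Sum>j\<in>J. gs ! j)" for J
  have "finite I"
    unfolding I_def using fin X(1) by (intro finite_UnI finite_imageI finite_SigmaI) auto
  have "card I \<le> card E + card (Sigma K X)"
    unfolding I_def using card_Un_le[of "(\<lambda>t. (t, a)) ` E" "Sigma K X"] card_image_le[OF fin(1)]
    by (meson add_le_mono1 le_trans)
  also have "\<dots> < l"
    using less fin X(1) by simp
  finally have "1 * 2 ^ card I < card (Pow {..<l})"
    by (simp add: card_Pow)
  from exists_large_fibre_bits[OF _ \<open>finite I\<close> this, of "\<lambda>J (t, x). field_trace l (poly (P J) x * bs ! t)"]
  obtain Y where Y: "Y \<subseteq> Pow {..<l}" "card Y > 1"
    and eqI: "\<forall>J\<in>Y. \<forall>J'\<in>Y. \<forall>i\<in>I. (case i of (t, x) \<Rightarrow> field_trace l (poly (P J) x * bs ! t))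
      = (case i of (t, x) \<Rightarrow> field_trace l (poly (P J') x * bs ! t))"
    by auto
  obtain J J' where J: "J \<in> Y" "J' \<in> Y" "J \<noteq> J'"
    using Y(2) by (metis One_nat_def card.empty card_le_Suc0_iff_eq card.infinite not_less zero_le)
  \<comment> \<open>Sum and difference coincide in characteristic 2, so conditions on which
    \<open>J\<close> and \<open>J'\<close> agree become zeros for \<open>p\<close>.\<close>
  define p where "p = P J + P J'"
  have trp: "field_trace l (poly p x * b) = field_trace l (poly (P J) x * b) +
      field_trace l (poly (P J') x * b)" for x b
    by (simp add: p_def distrib_right tr_add)
  have trp_0: "field_trace l (poly p x * bs ! t) = 0" if "(t, x) \<in> I" for x t
  proof -
    have "field_trace l (poly (P J) x * bs ! t) = field_trace l (poly (P J') x * bs ! t)"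
      using eqI J(1,2) that by fastforce
    then show ?thesis
      unfolding trp by simp
  qed
  have degP: "degree (P T) \<le> 2" if "T \<in> Y" for T
    unfolding P_def
  proof (rule degree_sum_le)
    have "T \<subseteq> {..<l}"
      using Y(1) that by blast
    then show "finite T" "\<And>j. j \<in> T \<Longrightarrow> degree (gs ! j) \<le> 2"
      using gs(1,2) finite_subset by auto
  qed
  have deg: "degree p \<le> 2"
    unfolding p_def using degP J by (intro degree_add_le) auto
  have zero_nodes_p: "field_trace l (poly p x * bs ! t) = 0" if "x \<in> zero_nodes l A bs gs t" for x t
  proof -
    have "field_trace l (poly (P T) x * bs ! t) = 0" if "T \<in> Y" for T
      unfolding P_def poly_sum sum_distrib_right tr_sum
      using Y(1) that \<open>x \<in> _\<close> by (intro sum.neutral) (auto simp: zero_nodes_def)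
    then show ?thesis
      unfolding trp using J by simp
  qed
  have pa: "poly p a \<noteq> 0"
  proof
    assume "poly p a = 0"
    then have "poly (P J) a + poly (P J') a = 0"
      by (simp add: p_def)
    then have "poly (P J) a = poly (P J') a"
      by (rule add_eq_0_imp_eq[OF card])
    moreover have "poly (P T) a = (\<Sum>j\<in>T. map (\<lambda>g. poly g a) gs ! j)" if "T \<in> Y" for T
      unfolding P_def poly_sum
    proof (rule sum.cong)
      fix j assume "j \<in> T"
      then have "j < length gs"
        using Y(1) that gs(1) by blast
      then show "poly (gs ! j) a = map (\<lambda>g. poly g a) gs ! j"
        by simp
    qed simp
    ultimately show False
      using inj_onD[OF inj_on_subset_sums[OF card gs(3)], of J J'] J Y(1) gs(1) by auto
  qed
  have zero_K: "field_trace l (poly p x * bs ! t) = 0" if "t \<in> K" "x \<in> A" for t x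
  proof -
    have "\<forall>y\<in>zero_nodes l A bs gs t \<union> X t. field_trace l (poly p y * bs ! t) = 0"
      using that(1) zero_nodes_p trp_0 by (auto simp: I_def)
    then show ?thesis
      using X(2)[OF that(1) affine2_map_trace_poly[OF card deg]] that(2) by blast
  qed
  \<comment> \<open>Only the coordinates outside \<open>K\<close> vary on \<open>A\<close>, so three
    nodes share a value of \<open>p\<close>, one more than its degree bound allows unless
    \<open>p\<close> is constant.\<close>
  have "card A > 2 * 2 ^ card ({..<l} - K)"
    using A K(1) fin by (simp add: card_Diff_subset)
  from exists_large_fibre_bits[OF _ _ this, of "\<lambda>x t. field_trace l (poly p x * bs ! t)"]
  obtain Z where Z: "Z \<subseteq> A" "card Z > 2"
    and eqZ: "\<forall>x\<in>Z. \<forall>y\<in>Z. \<forall>t\<in>{..<l} - K.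
      field_trace l (poly p x * bs ! t) = field_trace l (poly p y * bs ! t)"
    by auto
  obtain x0 where x0: "x0 \<in> Z"
    using Z(2) by fastforce
  have "poly p x = poly p x0" if "x \<in> Z" for x
  proof -
    have eq_t: "field_trace l (poly p x * bs ! t) = field_trace l (poly p x0 * bs ! t)" if "t < l" for t
    proof (cases "t \<in> K")
      case True
      then show ?thesis
        using zero_K[OF True, of x] zero_K[OF True, of x0] x0 \<open>x \<in> Z\<close> Z(1) by (simp add: subset_iff)
    next
      case False
      then show ?thesis
        using eqZ x0 \<open>x \<in> Z\<close> that by blast
    qed
    have "field_trace l ((poly p x + poly p x0) * b) = 0" if "b \<in> set bs" for b
    proof -
      obtain t where "t < l" "b = bs ! t"
        using \<open>b \<in> set bs\<close> bs(2) by (auto simp: in_set_conv_nth)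
      then show ?thesis
        using eq_t by (simp add: distrib_right tr_add)
    qed
    then have "poly p x + poly p x0 = 0"
      using eq_0_if_traces_eq_0[OF card bs(1)] by blast
    then show ?thesis
      by (rule add_eq_0_imp_eq[OF card])
  qed
  then have const: "p = [:poly p x0:]"
    using Z(2) deg by (intro poly_eqI_degree[of Z]) auto
  then have const': "poly p x = poly p a" for x
    by (metis poly_const_conv)
  obtain t where t: "t < l" "field_trace l (poly p a * bs ! t) \<noteq> 0"
    using eq_0_if_traces_eq_0[OF card bs(1), of "poly p a"] pa bs(2) by (metis in_set_conv_nth)
  \<comment> \<open>For \<open>t\<close> in \<open>E\<close> the condition at \<open>a\<close> kills
    this coordinate; otherwise a node with zero column \<open>t\<close> does, since \<open>p\<close>
    is constant.\<close>
  show False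
  proof (cases "t \<in> E")
    case True
    then show False
      using trp_0[of t a] t by (auto simp: I_def)
  next
    case False
    then obtain x where "x \<in> zero_nodes l A bs gs t"
      using E[OF t(1)] by blast
    then show False
      using zero_nodes_p[of x t] t(2) const'[of x] by simp
  qed
qed

lemma affine2_zero_nodes:
  fixes A :: "'a::finite_field set"
  assumes card: "CARD('a) = 2 ^ l" and "affine2 A"
    and gs: "length gs = l" "\<forall>g\<in>set gs. degree g \<le> 2"
  shows "affine2 (zero_nodes l A bs gs t)"
  unfolding affine2_def
proof (intro ballI)
  fix x y z assume xyz: "x \<in> zero_nodes l A bs gs t" "y \<in> zero_nodes l A bs gs t"
    "z \<in> zero_nodes l A bs gs t"
  have "field_trace l (poly (gs ! j) (x + y + z) * bs ! t) = 0" if "j < l" for j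
  proof -
    have "affine2_map UNIV (\<lambda>x. field_trace l (poly (gs ! j) x * bs ! t))"
      using gs that by (intro affine2_map_trace_poly[OF card]) auto
    then show ?thesis
      using xyz that by (simp add: affine2_map_def zero_nodes_def)
  qed
  moreover have "x + y + z \<in> A"
    using xyz assms(2) by (auto simp: affine2_def zero_nodes_def)
  ultimately show "x + y + z \<in> zero_nodes l A bs gs t"
    by (simp add: zero_nodes_def)
qed

text \<open>The subset sums of the \<open>l\<close> independent values at \<open>a\<close> exhaust
  the field by counting. A zero column would then make the trace vanish on all multiples of
  \<open>bs ! t\<close>, hence everywhere.\<close>

lemma not_in_zero_nodes:
  fixes gs :: "'a::finite_field poly list"
  assumes card: "CARD('a) = 2 ^ l" and bs: "basis_list bs" "length bs = l" and "t < l"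
    and gs: "length gs = l" "lin_indep_list (map (\<lambda>g. poly g a) gs)"
  shows "a \<notin> zero_nodes l A bs gs t"
proof
  assume a: "a \<in> zero_nodes l A bs gs t"
  interpret vector_space "bit_scale :: bit \<Rightarrow> 'a \<Rightarrow> 'a"
    by (rule vector_space_bit_scale[OF card])
  let ?vs = "map (\<lambda>g. poly g a) gs"
  have b0: "bs ! t \<noteq> 0"
    using bs \<open>t < l\<close> dependent_zero[of "set bs"] by (metis basis_list_def lin_indep_list_def nth_mem)
  have inj: "inj_on (\<lambda>J. \<Sum>j\<in>J. ?vs ! j) (Pow {..<l})"
    using inj_on_subset_sums[OF card gs(2)] gs(1) by simp
  have "(\<lambda>J. \<Sum>j\<in>J. ?vs ! j) ` Pow {..<l} = UNIV"
    by (rule card_subset_eq) (simp_all add: card_image[OF inj] card_Pow card)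
  moreover obtain x :: 'a where x: "field_trace l x \<noteq> 0"
    using exists_field_trace_nonzero[OF card] by blast
  ultimately obtain J where J: "J \<subseteq> {..<l}" "x / bs ! t = (\<Sum>j\<in>J. ?vs ! j)"
    by (metis (no_types, lifting) PowD UNIV_I imageE)
  have "x = (\<Sum>j\<in>J. ?vs ! j * bs ! t)"
    using J(2) b0 by (simp only: sum_distrib_right[symmetric]) (metis nonzero_divide_eq_eq)
  then have "field_trace l x = (\<Sum>j\<in>J. field_trace l (?vs ! j * bs ! t))"
    by (simp only: field_trace_sum[OF card])
  also have "\<dots> = 0"
    using J(1) a gs(1) by (intro sum.neutral) (auto simp: zero_nodes_def)
  finally show False
    using x by contradiction
qed

text \<open>A nonempty S_t has \<open>2 ^ (d - 1) * (1/2) ^ q t\<close> elements, so the weights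
  \<open>(1/2) ^ q t\<close> have to sum to at most \<open>l - d + 2\<close>. A larger sum would
  allow a \<open>K\<close> with fewer than \<open>l\<close> conditions in the core count.\<close>

lemma sum_card_zero_nodes_le:
  fixes A :: "'a::finite_field set" and gs :: "'a poly list"
  assumes card: "CARD('a) = 2 ^ l" and bs: "basis_list bs" "length bs = l"
    and gs: "length gs = l" "\<forall>g\<in>set gs. degree g \<le> 2" "lin_indep_list (map (\<lambda>g. poly g a) gs)"
    and A: "affine2 A" "a \<in> A" "card A = 2 ^ d" and d: "2 \<le> d" "d \<le> l"
  shows "(\<Sum>t<l. card (zero_nodes l A bs gs t)) \<le> (l - d + 2) * 2 ^ (d - 1)"
proof -
  define S where "S = zero_nodes l A bs gs"
  define E where "E = {t. t < l \<and> S t = {}}"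
  define T where "T = {..<l} - E"
  have E: "E \<subseteq> {..<l}" "finite E"
    by (auto simp: E_def)
  then have card_E: "card E \<le> l"
    using card_mono[of "{..<l}" E] by simp
  have T: "finite T" "card T = l - card E"
    using E by (simp_all add: T_def card_Diff_subset)
  have "\<exists>X. finite X \<and> X \<inter> S t = {} \<and> 2 ^ card X * card (S t) = card A \<and>
      (\<forall>f. affine2_map A f \<longrightarrow> (\<forall>x\<in>S t \<union> X. f x = 0) \<longrightarrow> (\<forall>x\<in>A. f x = 0))" if "t \<in> T" for t
  proof (rule affine2_spanning_set)
    show "affine2 (S t)"
      unfolding S_def by (rule affine2_zero_nodes[OF card A(1) gs(1,2)])
  qed (use that A(1) add_self_eq_0[OF card] in \<open>auto simp: T_def E_def S_def zero_nodes_def\<close>)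
  then obtain X where X: "\<And>t. t \<in> T \<Longrightarrow> finite (X t)"
    "\<And>t. t \<in> T \<Longrightarrow> 2 ^ card (X t) * card (S t) = 2 ^ d"
    "\<And>t f. t \<in> T \<Longrightarrow> affine2_map A f \<Longrightarrow> (\<forall>x\<in>S t \<union> X t. f x = 0) \<Longrightarrow> (\<forall>x\<in>A. f x = 0)"
    unfolding A(3) by metis
  \<comment> \<open>For \<open>t\<close> in \<open>T\<close>, \<open>card (X t)\<close> is the
    codimension of S_t. It is at least 1 because S_t misses the failed node, so the subtraction does
    not truncate.\<close>
  define q where "q t = card (X t) - 1" for t
  have card_X: "card (X t) = q t + 1" if "t \<in> T" for t
  proof -
    have "a \<notin> S t"
      unfolding S_def using that by (intro not_in_zero_nodes[OF card bs _ gs(1,3)]) (simp add: T_def)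
    moreover have "S t \<subseteq> A"
      by (auto simp: S_def zero_nodes_def)
    ultimately have "S t \<subset> A"
      using A(2) by blast
    then have "card (S t) < 2 ^ d"
      using psubset_card_mono[of A "S t"] A(3) by simp
    then have "card (X t) \<noteq> 0"
      using X(2)[OF that] by (metis mult_1 nat_less_le power_0)
    then show ?thesis
      unfolding q_def by linarith
  qed
  have card_S: "real (card (S t)) = 2 ^ (d - 1) * (1/2) ^ q t" if "t \<in> T" for t
  proof -
    have "(2::nat) ^ d = 2 * 2 ^ (d - 1)"
      using d(1) by (cases d) auto
    then have "2 * (2 ^ q t * card (S t)) = 2 * 2 ^ (d - 1)"
      using X(2)[OF that] by (simp add: card_X[OF that])
    then have "2 ^ q t * card (S t) = 2 ^ (d - 1)"
      by simp
    then have "2 ^ q t * real (card (S t)) = 2 ^ (d - 1)"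
      by (metis of_nat_mult of_nat_numeral of_nat_power)
    then show ?thesis
      by (simp add: power_divide field_simps)
  qed
  have "(\<Sum>t<l. real (card (S t))) = (\<Sum>t\<in>T. real (card (S t)))"
    by (rule sum.mono_neutral_right) (auto simp: T_def E_def)
  also have "\<dots> = 2 ^ (d - 1) * (\<Sum>t\<in>T. (1/2) ^ q t)"
    unfolding sum_distrib_left by (rule sum.cong) (simp_all add: card_S)
  also have "\<dots> \<le> 2 ^ (d - 1) * real (l - d + 2)"
  proof (rule mult_left_mono)
    have le_T: "(\<Sum>t\<in>T. (1/2::real) ^ q t) \<le> real (card T)"
      using sum_mono[of T "\<lambda>t. (1/2::real) ^ q t" "\<lambda>_. 1"] by (simp add: power_le_one)
    show "(\<Sum>t\<in>T. (1/2) ^ q t) \<le> real (l - d + 2)"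
    proof (rule ccontr)
      assume less: "\<not> ?thesis"
      \<comment> \<open>\<open>E\<close> and \<open>M\<close> together will be the
        \<open>d - 2\<close> coordinates outside \<open>K = T - M\<close>. As the sum exceeds
        \<open>l - d + 2\<close> but not \<open>card T = l - card E\<close>, it follows that
        \<open>card E < d - 2\<close> and \<open>m > 0\<close>; moreover
        \<open>card T - m = l - d + 2\<close>.\<close>
      define m where "m = d - 2 - card E"
      have m: "card E + 2 + m = d" "m > 0" "m \<le> card T"
        using less le_T T(2) card_E d by (auto simp: m_def)
      have "real (card T) - real m < (\<Sum>t\<in>T. (1/2) ^ q t)"
        using less m(1) T(2) card_E d by simp
      then obtain M where M: "M \<subseteq> T" "card M = m" "(\<Sum>t\<in>T - M. q t) < m"
        using exists_small_complement_sum[OF T(1) m(3,2)] by blast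
      have cardK: "card (T - M) = card T - m"
        using M T(1) by (simp add: card_Diff_subset finite_subset)
      have "l \<le> card E + (\<Sum>t\<in>T - M. card (X t))"
      proof (rule quadratic_scheme_system_overdetermined[OF card bs gs])
        have "l - card (T - M) = d - 2"
          using cardK m T(2) card_E d by simp
        \<comment> \<open>At most \<open>2 ^ (d - 2)\<close> values for \<open>2 ^ d\<close> nodes:
          more than two nodes per value on average.\<close>
        moreover have "2 * 2 ^ (d - 2) < (2::nat) ^ d"
        proof -
          have "(2::nat) ^ d = 2 ^ (d - 2) * 2 ^ 2"
            using d(1) by (metis le_add_diff_inverse2 power_add)
          then show ?thesis
            by simp
        qed
        ultimately show "2 * 2 ^ (l - card (T - M)) < card A"
          using A(3) by simp
        show "\<forall>x\<in>A. f x = 0" if "t \<in> T - M" "affine2_map A f"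
          "\<forall>x\<in>zero_nodes l A bs gs t \<union> X t. f x = 0" for t f
          using that X(3)[of t f] by (simp add: S_def)
      qed (use X(1) in \<open>auto simp: T_def E_def S_def\<close>)
      also have "(\<Sum>t\<in>T - M. card (X t)) = (\<Sum>t\<in>T - M. q t) + card (T - M)"
        by (simp add: card_X sum_Suc)
      \<comment> \<open>The sum of \<open>q\<close> is less than \<open>m\<close>, and
        \<open>card E + m + (card T - m) = l\<close>.\<close>
      also have "card E + \<dots> < l"
        using M(3) cardK m(3) T(2) card_E by linarith
      finally show False
        by simp
    qed
  qed simp
  finally have "real (\<Sum>t<l. card (S t)) \<le> real ((l - d + 2) * 2 ^ (d - 1))"
    by (simp only: of_nat_sum of_nat_mult of_nat_power of_nat_numeral mult.commute)
  then show ?thesis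
    unfolding S_def of_nat_le_iff .
qed

section \<open>From zero columns to the I/O cost\<close>

text \<open>Double counting of pairs of a node and a zero column. The \<open>l\<close> subtracted in
  \<open>io_cost\<close> lowers the factor \<open>length pts\<close> by 1.\<close>

lemma io_cost_eq:
  fixes pts bs :: "'a::finite_field list"
  assumes "length gs = l" and "distinct pts"
  shows "io_cost l pts bs gs = (int (length pts) - 1) * int l
    - int (\<Sum>t<l. card (zero_nodes l (set pts) bs gs t))"
proof -
  let ?Z = "\<lambda>x. {t. t < l \<and> x \<in> zero_nodes l (set pts) bs gs t}"
  have nz: "int (nz (repair_matrix l bs gs x)) = int l - int (card (?Z x))" if "x \<in> set pts" for x
  proof -
    have "{s. s < dim_col (repair_matrix l bs gs x) \<and>
        col (repair_matrix l bs gs x) s \<noteq> 0\<^sub>v (dim_row (repair_matrix l bs gs x))} = {..<l} - ?Z x"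
      using that by (auto simp: repair_matrix_def zero_nodes_def vec_eq_iff)
    moreover have "card ({..<l} - ?Z x) = l - card (?Z x)"
      by (subst card_Diff_subset) auto
    moreover have "card (?Z x) \<le> l"
      using card_mono[of "{..<l}" "?Z x"] by auto
    ultimately show ?thesis
      by (simp add: nz_def)
  qed
  have "(\<Sum>i<length pts. int (nz (repair_matrix l bs gs (pts ! i))))
      = (\<Sum>x\<in>set pts. int (nz (repair_matrix l bs gs x)))"
    by (rule sum.reindex_bij_betw[OF bij_betw_nth[OF assms(2)]]) auto
  also have "\<dots> = int (length pts) * int l - int (\<Sum>x\<in>set pts. card (?Z x))"
    using distinct_card[OF assms(2)] by (simp add: nz sum_subtractf)
  also have "(\<Sum>x\<in>set pts. card (?Z x)) = (\<Sum>x\<in>set pts. \<Sum>t<l. if x \<in> zero_nodes l (set pts) bs gs t then 1 else 0)"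
    by (simp add: sum.If_cases lessThan_def Collect_conj_eq)
  also have "\<dots> = (\<Sum>t<l. \<Sum>x\<in>set pts. if x \<in> zero_nodes l (set pts) bs gs t then 1 else 0)"
    by (rule sum.swap)
  also have "\<dots> = (\<Sum>t<l. card (zero_nodes l (set pts) bs gs t))"
    by (intro sum.cong) (auto simp: sum.If_cases zero_nodes_def Int_def)
  finally show ?thesis
    by (simp add: io_cost_def algebra_simps)
qed

theorem theorem16:
  fixes A :: "'a::finite_field set" and pts bs :: "'a list" and gs :: "'a poly list"
    and l d n k i :: nat
  assumes "CARD('a) = 2 ^ l" and "l > 1"
    and "Modules.module.subspace bit_scale A" and "vector_space.dim bit_scale A = d"
    and "n = 2 ^ d"
    and "k = 2 ^ d - 3" and "1 \<le> k"
    and "distinct pts" and "set pts = A" and "length pts = n"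
    and "length bs = l" and "basis_list bs"
    and "i < n" and "linear_repair_scheme pts k l i gs"
  shows "io_cost l pts bs gs \<ge> (int n - 1) * int l - (int l - int d + 2) * 2 ^ (d - 1)"
proof -
  interpret vector_space "bit_scale :: bit \<Rightarrow> 'a \<Rightarrow> 'a"
    by (rule vector_space_bit_scale[OF assms(1)])
  have cardA: "card A = 2 ^ d"
    using distinct_card[OF assms(8)] assms by simp
  \<comment> \<open>\<open>1 \<le> k\<close> rules out truncation in \<open>2 ^ d - 3\<close>, so
    \<open>length pts - k\<close> is exactly 3 and the polynomials are at most quadratic.\<close>
  have big: "(2::nat) ^ d > 3"
    using assms(6,7) by simp
  have "2 \<le> d"
  proof (rule ccontr)
    assume "\<not> 2 \<le> d"
    then have "(2::nat) ^ d \<le> 2 ^ 1"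
      by (intro power_increasing) auto
    then show False
      using big by simp
  qed
  have "(2::nat) ^ d \<le> 2 ^ l"
    using card_mono[of UNIV A] cardA assms(1) by simp
  then have "d \<le> l"
    by simp
  have "affine2 A"
    using assms(3) by (simp add: affine2_def subspace_add)
  have "length pts - k = 3"
    using assms(5,6,10) big by simp
  then have gs: "length gs = l" "\<forall>g\<in>set gs. degree g \<le> 2"
    "lin_indep_list (map (\<lambda>g. poly g (pts ! i)) gs)"
    using assms(14) unfolding linear_repair_scheme_def by auto
  have "pts ! i \<in> A"
    using assms(9,10,13) nth_mem by blast
  from sum_card_zero_nodes_le[OF assms(1,12,11) gs \<open>affine2 A\<close> this cardA \<open>2 \<le> d\<close> \<open>d \<le> l\<close>]
  have "int (\<Sum>t<l. card (zero_nodes l A bs gs t)) \<le> int ((l - d + 2) * 2 ^ (d - 1))"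
    by (rule of_nat_mono)
  also have "\<dots> = (int l - int d + 2) * 2 ^ (d - 1)"
    using \<open>d \<le> l\<close> by (simp only: of_nat_mult of_nat_power of_nat_numeral of_nat_add of_nat_diff)
  finally show ?thesis
    using io_cost_eq[OF gs(1) assms(8), of bs] assms(9,10) by simp
qed

end
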